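(* Consider a nondegenerate Euclidean tetrahedron $\{1,2,3,4\}$ with a metric $d$ inducing edge lengths $\ell_{ij}$, and let $\beta_{ij}$ be its dihedral angle at edge $\{i,j\}$, regarded as a function of the six edge lengths. Under (first-order) variations of the edge lengths of the form $$\delta\ell_{12}=\delta\ell_{13}=\delta\ell_{23}=0,\qquad \delta\ell_{14}=d_{41}\,\delta f_4,\qquad \delta\ell_{24}=d_{42}\,\delta f_4,\qquad \delta\ell_{34}=d_{43}\,\delta f_4,$$ with $\delta f_4$ arbitrary, the corresponding first-order variations $\delta\beta_{ij}$ of the dihedral angles satisfy $$d_{14}\,\delta\beta_{14}+d_{12}\,\delta\beta_{12}+d_{13}\,\delta\beta_{13}=2\frac{A_{14,23}}{\ell_{14}}\,\delta f_4,$$ $$d_{24}\,\delta\beta_{24}+d_{23}\,\delta\beta_{23}+d_{21}\,\delta\beta_{12}=2\frac{A_{24,13}}{\ell_{24}}\,\delta f_4,$$ $$d_{34}\,\delta\beta_{34}+d_{32}\,\delta\beta_{23}+d_{31}\,\delta\beta_{13}=2\frac{A_{34,12}}{\ell_{34}}\,\delta f_4,$$ $$d_{41}\,\delta\beta_{14}+d_{42}\,\delta\beta_{24}+d_{43}\,\delta\beta_{34}=\left[-2\frac{A_{14,23}}{\ell_{14}}-2\frac{A_{24,13}}{\ell_{24}}-2\frac{A_{34,12}}{\ell_{34}}\right]\delta f_4 .$$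
   Context: A metric $d$ on the tetrahedron $\{1,2,3,4\}$ is an assignment of real numbers $d_{ij}$ (possibly negative) to the ordered pairs $(i,j)$, $i\neq j$, such that $\ell_{ij}=d_{ij}+d_{ji}$ are the edge lengths of a nondegenerate Euclidean tetrahedron and for every triangular face $\{i,j,k\}$: $d_{ij}^2+d_{jk}^2+d_{ki}^2=d_{ji}^2+d_{ik}^2+d_{kj}^2$. Let $\gamma_{i,jk}$ be the angle at vertex $i$ in the face $\{i,j,k\}$ and $\beta_{ij}=\beta_{ij,k\ell}$ the dihedral angle at edge $\{i,j\}$, where $\{i,j,k,\ell\}=\{1,2,3,4\}$. Define $$h_{ij,k}=\frac{d_{ik}-d_{ij}\cos\gamma_{i,jk}}{\sin\gamma_{i,jk}},\qquad h_{ijk,\ell}=\frac{h_{ij,\ell}-h_{ij,k}\cos\beta_{ij,k\ell}}{\sin\beta_{ij,k\ell}},\qquad A_{ij,k\ell}=\tfrac12\left(h_{ij,k}h_{ijk,\ell}+h_{ij,\ell}h_{ij\ell,k}\right).$$ Geometrically, $h_{ij,k}$ is the signed distance within the face $\{i,j,k\}$ from the face's center to the edge $\{i,j\}$, $h_{ijk,\ell}$ is the signed distance from the tetrahedron's center to the face $\{i,j,k\}$ (the centers being determined by $d$: they project orthogonally to the point of the line $v_iv_j$ at signed distance $d_{ij}$ from $v_i$ toward $v_j$), and $A_{ij,k\ell}$ is the signed area of the dual of $\{i,j\}$ in the tetrahedron. The $\delta\beta_{ij}$ are the differentials of $\beta_{ij}$ (as functions of the edge lengths) applied to the given length variation $\delta\ell$.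 *)

theory Defs
  imports "HOL-Analysis.Analysis"
begin

text \<open>
  The vertices are the elements \<open>1, 2, 3, 4\<close> of the four-element numeral type \<open>4\<close>
  (in which \<open>4 = 0\<close>). An assignment of lengths to the six edges is a vector of
  \<open>real^edge\<close>, so that functions of the edge lengths have Frechet derivatives
  on a six-dimensional Euclidean space.
\<close>

typedef edge = "{e :: 4 set. card e = 2}"
proof
  show "{1, 2} \<in> {e :: 4 set. card e = 2}" by simp
qed

instance edge :: finite
proof
  have "finite (Rep_edge ` (UNIV :: edge set))" by simp
  then show "finite (UNIV :: edge set)"
    by (rule finite_imageD) (simp add: inj_on_def Rep_edge_inject)
qed

definition edge :: "4 \<Rightarrow> 4 \<Rightarrow> edge" where
  "edge i j = Abs_edge {i, j}"

text \<open>\<open>edge i j\<close> is meaningful only for \<open>i \<noteq> j\<close>.\<close>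

lemma Rep_edge_edge: "i \<noteq> j \<Longrightarrow> Rep_edge (edge i j) = {i, j}"
  by (simp add: edge_def Abs_edge_inverse)

lemma edge_commute: "edge i j = edge j i"
  by (simp add: edge_def insert_commute)


definition vec_angle :: "'a::real_inner \<Rightarrow> 'a \<Rightarrow> real" where
  "vec_angle x y = arccos ((x \<bullet> y) / (norm x * norm y))"

definition perp_part :: "'a::real_inner \<Rightarrow> 'a \<Rightarrow> 'a" where
  "perp_part e x = x - ((x \<bullet> e) / (e \<bullet> e)) *\<^sub>R e"

text \<open>\<open>realizes L v\<close>: the points \<open>v 1, \<dots>, v 4\<close> are the vertices of a nondegenerate
  Euclidean tetrahedron with edge lengths \<open>L\<close>.\<close>

definition realizes :: "real^edge \<Rightarrow> (4 \<Rightarrow> real^3) \<Rightarrow> bool" where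
  "realizes L v \<longleftrightarrow> inj v \<and> \<not> affine_dependent (range v) \<and>
     (\<forall>i j. i \<noteq> j \<longrightarrow> dist (v i) (v j) = L $ edge i j)"

text \<open>
  Angles as functions of the edge lengths, computed in an arbitrarily chosen tetrahedron with
  these lengths; by \<open>face_angle_eq\<close> and \<open>dihedral_angle_eq\<close> below they do not depend on the
  choice. \<open>face_angle L i j k\<close> is the angle at \<open>i\<close> in the face \<open>{i, j, k}\<close>, and
  \<open>dihedral_angle L i j k l\<close> is the interior dihedral angle at the edge \<open>{i, j}\<close>, where
  \<open>{i, j, k, l} = {1, 2, 3, 4}\<close>, i.e. the angle between the faces \<open>{i, j, k}\<close> and \<open>{i, j, l}\<close>.
\<close>

definition realization :: "real^edge \<Rightarrow> 4 \<Rightarrow> real^3" where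
  "realization L = (SOME v. realizes L v)"

definition face_angle :: "real^edge \<Rightarrow> 4 \<Rightarrow> 4 \<Rightarrow> 4 \<Rightarrow> real" where
  "face_angle L i j k =
     (let v = realization L in vec_angle (v j - v i) (v k - v i))"

definition dihedral_angle :: "real^edge \<Rightarrow> 4 \<Rightarrow> 4 \<Rightarrow> 4 \<Rightarrow> 4 \<Rightarrow> real" where
  "dihedral_angle L i j k l =
     (let v = realization L in
        vec_angle (perp_part (v j - v i) (v k - v i)) (perp_part (v j - v i) (v l - v i)))"

lemma realizes_inner_eq:
  assumes "realizes L v" "realizes L w"
  shows "(v j - v i) \<bullet> (v k - v i) = (w j - w i) \<bullet> (w k - w i)"
proof -
  have d: "dist (v a) (v b) = dist (w a) (w b)" for a b
    using assms by (cases "a = b") (auto simp: realizes_def)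
  have *: "(u j - u i) \<bullet> (u k - u i) =
      ((dist (u j) (u i))\<^sup>2 + (dist (u k) (u i))\<^sup>2 - (dist (u j) (u k))\<^sup>2) / 2" for u :: "4 \<Rightarrow> real^3"
    using dot_norm_neg[of "u j - u i" "u k - u i"] by (simp add: dist_norm)
  show ?thesis
    by (simp add: * d)
qed

lemma face_angle_eq:
  assumes "realizes L v"
  shows "face_angle L i j k = vec_angle (v j - v i) (v k - v i)"
proof -
  have "realizes L (realization L)"
    unfolding realization_def using assms by (rule someI[of "realizes L"])
  note eq = realizes_inner_eq[OF this assms]
  show ?thesis
    by (simp add: face_angle_def Let_def vec_angle_def norm_eq_sqrt_inner eq)
qed

lemma dihedral_angle_eq:
  assumes "realizes L v"
  shows "dihedral_angle L i j k l =
    vec_angle (perp_part (v j - v i) (v k - v i)) (perp_part (v j - v i) (v l - v i))"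
proof -
  have "realizes L (realization L)"
    unfolding realization_def using assms by (rule someI[of "realizes L"])
  note eq = realizes_inner_eq[OF this assms]
  have *: "perp_part e x \<bullet> perp_part e y =
      x \<bullet> y - (y \<bullet> e) / (e \<bullet> e) * (x \<bullet> e) - (x \<bullet> e) / (e \<bullet> e) * (e \<bullet> y)
      + (x \<bullet> e) / (e \<bullet> e) * ((y \<bullet> e) / (e \<bullet> e)) * (e \<bullet> e)" for e x y :: "real^3"
    by (simp add: perp_part_def inner_diff_left inner_diff_right algebra_simps)
  show ?thesis
    by (simp only: dihedral_angle_def Let_def vec_angle_def norm_eq_sqrt_inner * eq)
qed


text \<open>Here \<open>d\<close> assigns a real number to each ordered pair of distinct vertices; the
  values \<open>d i i\<close> are irrelevant. In \<open>edge_lengths\<close> the sum has two terms, \<open>(i, j)\<close>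
  and \<open>(j, i)\<close>.\<close>

definition edge_lengths :: "(4 \<Rightarrow> 4 \<Rightarrow> real) \<Rightarrow> real^edge" where
  "edge_lengths d = (\<chi> e. \<Sum>(i, j) | Rep_edge e = {i, j}. d i j)"

lemma edge_lengths_edge:
  assumes "i \<noteq> j"
  shows "edge_lengths d $ edge i j = d i j + d j i"
proof -
  have "{(a, b). Rep_edge (edge i j) = {a, b}} = {(i, j), (j, i)}"
    using assms by (auto simp: Rep_edge_edge doubleton_eq_iff)
  then show ?thesis
    using assms by (simp add: edge_lengths_def)
qed

definition tetrahedron_metric :: "(4 \<Rightarrow> 4 \<Rightarrow> real) \<Rightarrow> bool" where
  "tetrahedron_metric d \<longleftrightarrow> (\<exists>v. realizes (edge_lengths d) v) \<and>
     (\<forall>i j k. distinct [i, j, k] \<longrightarrow>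
        (d i j)\<^sup>2 + (d j k)\<^sup>2 + (d k i)\<^sup>2 = (d j i)\<^sup>2 + (d i k)\<^sup>2 + (d k j)\<^sup>2)"

definition h_edge :: "(4 \<Rightarrow> 4 \<Rightarrow> real) \<Rightarrow> 4 \<Rightarrow> 4 \<Rightarrow> 4 \<Rightarrow> real" where
  "h_edge d i j k =
     (let \<gamma> = face_angle (edge_lengths d) i j k in (d i k - d i j * cos \<gamma>) / sin \<gamma>)"

definition h_face :: "(4 \<Rightarrow> 4 \<Rightarrow> real) \<Rightarrow> 4 \<Rightarrow> 4 \<Rightarrow> 4 \<Rightarrow> 4 \<Rightarrow> real" where
  "h_face d i j k l =
     (let \<beta> = dihedral_angle (edge_lengths d) i j k l
      in (h_edge d i j l - h_edge d i j k * cos \<beta>) / sin \<beta>)"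

definition dual_area :: "(4 \<Rightarrow> 4 \<Rightarrow> real) \<Rightarrow> 4 \<Rightarrow> 4 \<Rightarrow> 4 \<Rightarrow> 4 \<Rightarrow> real" where
  "dual_area d i j k l =
     (h_edge d i j k * h_face d i j k l + h_edge d i j l * h_face d i j l k) / 2"

text \<open>First-order variation of the dihedral angle at \<open>L\<close> under the variation \<open>\<delta>L\<close> of the edge
  lengths; meaningful where the dihedral angle is differentiable.\<close>

definition dihedral_variation ::
    "real^edge \<Rightarrow> real^edge \<Rightarrow> 4 \<Rightarrow> 4 \<Rightarrow> 4 \<Rightarrow> 4 \<Rightarrow> real" where
  "dihedral_variation L \<delta>L i j k l =
     frechet_derivative (\<lambda>L'. dihedral_angle L' i j k l) (at L) \<delta>L"

end

theory Submission
  imports Defs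
begin

text \<open>
  The metric has a center: a point \<open>c\<close> whose orthogonal projections to the edge lines are the points
  prescribed by \<open>d\<close>, so that \<open>d i j\<close> is the component of \<open>c - v i\<close> along the edge from \<open>v i\<close> to \<open>v j\<close>
  (\<open>exists_center\<close>). Seen from there, the length variation in the theorem is a motion of a single vertex:
  if \<open>v 4\<close> moves with velocity \<open>\<delta>f *\<^sub>R (v 4 - c)\<close>, radially away from the center, the length of the edge
  \<open>{i, 4}\<close> changes at the rate \<open>d 4 i * \<delta>f\<close>. The variations of the dihedral angles can thus be
  computed on an explicit curve of tetrahedra, once the angles are known to be differentiable functions of
  the lengths (\<open>dihedral_angle_differentiable\<close>, \<open>dihedral_variation_move_vertex\<close>).

  When \<open>v 4\<close> moves with velocity \<open>y\<close>, each of the three faces at \<open>v 4\<close> tilts, and the tilt is measured by one number, the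
  normal component of \<open>y\<close> over twice the area (\<open>face_rate\<close>). Every variation \<open>\<delta>\<beta>\<close> is a linear combination of these
  numbers (\<open>dihedral_variation_opposite\<close>, \<open>dihedral_variation_adjacent\<close>). For radial \<open>y\<close> the normal component is the
  distance of \<open>c\<close> from the face up to sign, hence given by \<open>h_face\<close>. In the weighted sum of the \<open>\<delta>\<beta>\<close> at a vertex
  \<open>i \<noteq> 4\<close> the weights combine, in each of the two moving faces at \<open>{i, 4}\<close>, to the in-plane
  distance of \<open>c\<close> from this edge, that is, to \<open>h_edge\<close>. The sum of the two products of distances is twice the dual area,
  which gives the first three identities (\<open>vertex_identity\<close>).

  The four left-hand sides add up to the sum of the \<open>\<delta>\<beta>\<close> weighted by the edge lengths. This sum vanishes by the
  Schlaefli identity (\<open>schlaefli_moving_vertex\<close>), and so the fourth identity follows from the other three.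
\<close>

unbundle cross3_syntax

section \<open>Vectors and angles in space\<close>

lemma cross_cross_common:
  fixes e p q :: "real^3"
  shows "(e \<times> p) \<times> (e \<times> q) = ((e \<times> p) \<bullet> q) *\<^sub>R e"
  by (simp add: Lagrange dot_cross_self cross_triple inner_commute)

lemma inner_perp_part:
  fixes e p q :: "real^3"
  assumes "e \<noteq> 0"
  shows "perp_part e p \<bullet> perp_part e q = ((e \<times> p) \<bullet> (e \<times> q)) / (e \<bullet> e)"
  using assms
  by (simp add: perp_part_def dot_cross inner_diff_left inner_diff_right field_simps inner_commute)

text \<open>
  The cross product with \<open>e\<close> is, on the plane orthogonal to \<open>e\<close>, a quarter turn composed with scaling
  by \<open>norm e\<close>. A dihedral angle is therefore the angle between two face normals, and unlike
  projections these are bilinear in the edge vectors.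
\<close>

lemma vec_angle_perp_part:
  fixes e p q :: "real^3"
  assumes "e \<noteq> 0"
  shows "vec_angle (perp_part e p) (perp_part e q) = vec_angle (e \<times> p) (e \<times> q)"
proof -
  have n: "norm (perp_part e p) = norm (e \<times> p) / norm e" for p
    using assms by (simp add: norm_eq_sqrt_inner inner_perp_part real_sqrt_divide)
  show ?thesis
    using assms by (simp add: vec_angle_def n inner_perp_part power2_norm_eq_inner flip: power2_eq_square)
qed

lemma cos_vec_angle:
  assumes "x \<noteq> 0" "y \<noteq> 0"
  shows "cos (vec_angle x y) = (x \<bullet> y) / (norm x * norm y)"
proof -
  have "\<bar>x \<bullet> y / (norm x * norm y)\<bar> \<le> 1"
    using Cauchy_Schwarz_ineq2[of x y] assms by (simp add: divide_le_eq_1 zero_less_mult_iff)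
  then show ?thesis
    by (simp add: vec_angle_def cos_arccos_abs)
qed

lemma sin_vec_angle:
  fixes x y :: "real^3"
  assumes "x \<noteq> 0" "y \<noteq> 0"
  shows "sin (vec_angle x y) = norm (x \<times> y) / (norm x * norm y)"
proof -
  have "\<bar>x \<bullet> y / (norm x * norm y)\<bar> \<le> 1"
    using Cauchy_Schwarz_ineq2[of x y] assms by (simp add: divide_le_eq_1 zero_less_mult_iff)
  then have "sin (vec_angle x y) = sqrt (1 - ((x \<bullet> y) / (norm x * norm y))\<^sup>2)"
    by (simp add: vec_angle_def sin_arccos_abs)
  also have "1 - ((x \<bullet> y) / (norm x * norm y))\<^sup>2 = (norm (x \<times> y) / (norm x * norm y))\<^sup>2"
    using assms by (simp add: norm_cross power_divide power_mult_distrib diff_divide_distrib)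
  finally show ?thesis by simp
qed

section \<open>First-order variation of a dihedral angle\<close>

text \<open>
  The quotient of the derivative rule is cleared of square roots: the only root left is
  \<open>S\<close>, which for two vectors in space will be the length of their cross product.
\<close>

lemma has_real_derivative_arccos_ratio:
  fixes P Q R :: "real \<Rightarrow> real"
  assumes d: "(P has_real_derivative P') (at t)" "(Q has_real_derivative Q') (at t)"
      "(R has_real_derivative R') (at t)"
    and pos: "Q t > 0" "R t > 0" "S > 0" and S: "S\<^sup>2 = Q t * R t - (P t)\<^sup>2"
  shows "((\<lambda>t. arccos (P t / (sqrt (Q t) * sqrt (R t)))) has_real_derivative
    (P t * (Q' * R t + Q t * R') - 2 * Q t * R t * P') / (2 * Q t * R t * S)) (at t)"
proof -
  define z where "z = P t / (sqrt (Q t) * sqrt (R t))"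
  define N where "N = sqrt (Q t) * sqrt (R t)"
  have N: "N > 0" "N\<^sup>2 = Q t * R t"
    using pos by (simp_all add: N_def power_mult_distrib)
  have "1 - z\<^sup>2 = (N\<^sup>2 - (P t)\<^sup>2) / N\<^sup>2"
    using N(1) by (simp add: z_def N_def[symmetric] power_divide diff_divide_distrib)
  also have "\<dots> = (S / N)\<^sup>2"
    unfolding N(2) S[symmetric] power_divide ..
  finally have "1 - z\<^sup>2 = (S / N)\<^sup>2" .
  then have sq: "sqrt (1 - z\<^sup>2) = S / N"
    using N(1) pos(3) by simp
  have "(S / N)\<^sup>2 > 0" using N(1) pos(3) by simp
  then have "z\<^sup>2 < 1" using \<open>1 - z\<^sup>2 = (S / N)\<^sup>2\<close> by linarith
  then have z: "-1 < z" "z < 1"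
    by (simp_all add: abs_square_less_1 abs_less_iff)
  have dN: "((\<lambda>t. sqrt (Q t) * sqrt (R t)) has_real_derivative (Q' * R t + Q t * R') / (2 * N)) (at t)"
  proof -
    have eq: "Q' * inverse (sqrt (Q t)) / 2 * sqrt (R t) + R' * inverse (sqrt (R t)) / 2 * sqrt (Q t)
       = (Q' * R t + Q t * R') / (2 * N)"
    proof -
      define a where "a = sqrt (Q t)"
      define b where "b = sqrt (R t)"
      have ab: "a > 0" "b > 0" "Q t = a\<^sup>2" "R t = b\<^sup>2"
        using pos by (auto simp: a_def b_def)
      show ?thesis
        unfolding N_def a_def[symmetric] b_def[symmetric] unfolding ab(3,4)
        using ab(1,2) by (simp add: field_simps power2_eq_square)
    qed
    show ?thesis
      using DERIV_mult[OF DERIV_chain2[OF DERIV_real_sqrt[OF pos(1)] d(2)]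
          DERIV_chain2[OF DERIV_real_sqrt[OF pos(2)] d(3)]] eq
      by (simp add: mult.commute mult.left_commute)
  qed
  have dz: "((\<lambda>t. P t / (sqrt (Q t) * sqrt (R t))) has_real_derivative
      (P' * N - P t * ((Q' * R t + Q t * R') / (2 * N))) / (N * N)) (at t)"
    unfolding N_def using DERIV_divide[OF d(1) dN] N(1) unfolding N_def by (metis less_irrefl)
  have "((\<lambda>t. arccos (P t / (sqrt (Q t) * sqrt (R t)))) has_real_derivative
     inverse (- sqrt (1 - z\<^sup>2)) * ((P' * N - P t * ((Q' * R t + Q t * R') / (2 * N))) / (N * N))) (at t)"
    using DERIV_chain2[OF DERIV_arccos[OF z, unfolded z_def] dz] unfolding z_def .
  moreover have "inverse (- sqrt (1 - z\<^sup>2)) * ((P' * N - P t * (K / (2 * N))) / (N * N))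
    = (P t * K - 2 * N\<^sup>2 * P') / (2 * N\<^sup>2 * S)" for K
    unfolding sq using N(1) pos(3) by (simp add: divide_simps power2_eq_square)
  ultimately show ?thesis
    unfolding N(2) by (simp add: mult.assoc)
qed

text \<open>
  The vector \<open>u \<times> (u \<times> w)\<close> lies in the plane of \<open>u\<close> and \<open>w\<close>, is orthogonal to \<open>u\<close> and points away
  from \<open>w\<close>; so each summand is the speed at which one of the two vectors turns away from the other.
\<close>

lemma vec_angle_line_derivative:
  fixes u w u' w' :: "real^3"
  assumes "u \<times> w \<noteq> 0"
  shows "((\<lambda>t. vec_angle (u + t *\<^sub>R u') (w + t *\<^sub>R w')) has_real_derivative
    ((u \<times> (u \<times> w)) \<bullet> u' / (norm u)\<^sup>2 + (w \<times> (w \<times> u)) \<bullet> w' / (norm w)\<^sup>2) / norm (u \<times> w)) (at 0)"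
proof -
  have nz: "u \<noteq> 0" "w \<noteq> 0" using assms by auto
  have d: "((\<lambda>t. (x + t *\<^sub>R x') \<bullet> (y + t *\<^sub>R y')) has_real_derivative (x' \<bullet> y + x \<bullet> y')) (at 0)"
    for x x' y y' :: "real^3"
    by (simp add: inner_add_left inner_add_right)
       (rule derivative_eq_intros refl | simp)+
  have S: "(norm (u \<times> w))\<^sup>2 = (u \<bullet> u) * (w \<bullet> w) - (u \<bullet> w)\<^sup>2"
    by (simp add: power2_norm_eq_inner dot_cross inner_commute) (simp add: power2_eq_square)
  have pos: "u \<bullet> u > 0" "w \<bullet> w > 0" "norm (u \<times> w) > 0"
    using nz assms by simp_all
  have "((\<lambda>t. vec_angle (u + t *\<^sub>R u') (w + t *\<^sub>R w')) has_real_derivative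
      ((u \<bullet> w) * ((u' \<bullet> u + u \<bullet> u') * (w \<bullet> w) + (u \<bullet> u) * (w' \<bullet> w + w \<bullet> w'))
         - 2 * (u \<bullet> u) * (w \<bullet> w) * (u' \<bullet> w + u \<bullet> w')) / (2 * (u \<bullet> u) * (w \<bullet> w) * norm (u \<times> w))) (at 0)"
    using has_real_derivative_arccos_ratio[OF d[of u u' w w'] d[of u u' u u'] d[of w w' w w'], of "norm (u \<times> w)"]
      pos S by (simp add: vec_angle_def norm_eq_sqrt_inner)
  moreover have "((u \<bullet> w) * ((u' \<bullet> u + u \<bullet> u') * (w \<bullet> w) + (u \<bullet> u) * (w' \<bullet> w + w \<bullet> w'))
         - 2 * (u \<bullet> u) * (w \<bullet> w) * (u' \<bullet> w + u \<bullet> w')) / (2 * (u \<bullet> u) * (w \<bullet> w) * norm (u \<times> w))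
     = ((u \<times> (u \<times> w)) \<bullet> u' / (norm u)\<^sup>2 + (w \<times> (w \<times> u)) \<bullet> w' / (norm w)\<^sup>2) / norm (u \<times> w)"
  proof -
    have uv: "(u \<times> (u \<times> w)) \<bullet> u' = (u \<bullet> w) * (u \<bullet> u') - (u \<bullet> u) * (u' \<bullet> w)"
      "(w \<times> (w \<times> u)) \<bullet> w' = (u \<bullet> w) * (w \<bullet> w') - (w \<bullet> w) * (u \<bullet> w')"
      by (simp_all add: Lagrange inner_diff_left inner_commute[of w u] inner_commute[of w u'])
    have "(P * ((a + a) * R + Q * (b + b)) - 2 * Q * R * (c + c')) / (2 * Q * R * S)
      = ((P * a - Q * c) / Q + (P * b - R * c') / R) / S"
      if "Q > 0" "R > 0" "S > 0" for P Q R S a b c c' :: real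
      using that by (simp add: divide_simps) (simp add: algebra_simps)
    from this[OF pos, of "u \<bullet> w" "u \<bullet> u'" "w \<bullet> w'" "u' \<bullet> w" "u \<bullet> w'"]
    show ?thesis
      unfolding uv power2_norm_eq_inner by (simp add: inner_commute)
  qed
  ultimately show ?thesis by simp
qed

lemma cross_add_scaleR_left: "(x + t *\<^sub>R y) \<times> z = x \<times> z + t *\<^sub>R (y \<times> z)" for x y z :: "real^3"
  by (simp add: cross_add_left cross_mult_left)

lemma cross_add_scaleR_right: "z \<times> (x + t *\<^sub>R y) = z \<times> x + t *\<^sub>R (z \<times> y)" for x y z :: "real^3"
  by (simp add: cross_add_right cross_mult_right)

text \<open>
  For face normals \<open>e \<times> p\<close> and \<open>e \<times> q\<close> the double cross products collapse, because the cross product of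
  the normals is a multiple of the common edge \<open>e\<close>. The contributions of the two faces become separate:
  apart from the orientation sign, neither involves the other face.
\<close>

lemma dihedral_line_derivative:
  fixes e p q u' w' :: "real^3"
  assumes "(e \<times> p) \<bullet> q \<noteq> 0"
  shows "((\<lambda>t. vec_angle (e \<times> p + t *\<^sub>R u') (e \<times> q + t *\<^sub>R w')) has_real_derivative
    sgn ((e \<times> p) \<bullet> q) * (((e \<times> p) \<times> e) \<bullet> u' / (norm (e \<times> p))\<^sup>2
      - ((e \<times> q) \<times> e) \<bullet> w' / (norm (e \<times> q))\<^sup>2) / norm e) (at 0)"
proof -
  define D where "D = (e \<times> p) \<bullet> q"
  have D: "D \<noteq> 0" using assms D_def by simp
  have e: "e \<noteq> 0" using assms by auto
  have uw: "(e \<times> p) \<times> (e \<times> q) = D *\<^sub>R e" "(e \<times> q) \<times> (e \<times> p) = (- D) *\<^sub>R e"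
    using cross_cross_common[of e p q] cross_skew[of "e \<times> q" "e \<times> p"] by (simp_all add: D_def)
  have "(e \<times> p) \<times> (e \<times> q) \<noteq> 0" using uw D e by simp
  from vec_angle_line_derivative[OF this, of u' w'] show ?thesis
    using D e unfolding uw D_def[symmetric]
    by (cases "D > 0") (simp_all add: cross_mult_right diff_divide_distrib)
qed

text \<open>
  Moving a vertex that does not lie on the edge only turns the face that contains it. The angular speed is the
  velocity normal to this face divided by the height of the vertex over the edge.
\<close>

lemma dihedral_derivative_opposite:
  fixes e p q y :: "real^3"
  assumes D: "(e \<times> p) \<bullet> q \<noteq> 0"
  shows "((\<lambda>t. vec_angle (perp_part e p) (perp_part e (q + t *\<^sub>R y))) has_real_derivative
    norm e * (sgn ((e \<times> p) \<bullet> q) * (y \<bullet> (e \<times> q)) / (norm (e \<times> q))\<^sup>2)) (at 0)"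
proof -
  have e: "e \<noteq> 0" using D by auto
  have "((e \<times> q) \<times> e) \<bullet> (e \<times> y) = - (norm e)\<^sup>2 * (y \<bullet> (e \<times> q))"
    by (simp add: dot_cross dot_cross_self power2_norm_eq_inner inner_commute)
  then show ?thesis
    using dihedral_line_derivative[OF D, of 0 "e \<times> y"] e
    by (simp add: vec_angle_perp_part cross_add_scaleR_right power2_eq_square mult.left_commute)
qed

lemma eventually_line_ne_0:
  fixes e y :: "'a::real_normed_vector"
  assumes "e \<noteq> 0"
  shows "\<forall>\<^sub>F t in nhds (0::real). e + t *\<^sub>R y \<noteq> 0"
proof -
  have "((\<lambda>t. e + t *\<^sub>R y) \<longlongrightarrow> e + 0 *\<^sub>R y) (nhds (0::real))"
    by (intro tendsto_intros filterlim_ident)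
  then have "((\<lambda>t. e + t *\<^sub>R y) \<longlongrightarrow> e) (nhds (0::real))" by simp
  then show ?thesis using assms by (rule tendsto_imp_eventually_ne)
qed

text \<open>
  Moving an endpoint of the edge tilts the edge itself, so both faces turn; the result is a combination
  of the same two normal velocities as in \<open>dihedral_derivative_opposite\<close>, one for each face.
\<close>

lemma dihedral_derivative_adjacent:
  fixes e p q y :: "real^3"
  assumes D: "(e \<times> p) \<bullet> q \<noteq> 0"
  shows "((\<lambda>t. vec_angle (perp_part (e + t *\<^sub>R y) p) (perp_part (e + t *\<^sub>R y) q)) has_real_derivative
    sgn ((e \<times> p) \<bullet> q) * ((e \<bullet> p) * (y \<bullet> (e \<times> p)) / (norm (e \<times> p))\<^sup>2
       - (e \<bullet> q) * (y \<bullet> (e \<times> q)) / (norm (e \<times> q))\<^sup>2) / norm e) (at 0)"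
proof -
  have e: "e \<noteq> 0" using D by auto
  have *: "((e \<times> x) \<times> e) \<bullet> (y \<times> x) = (e \<bullet> x) * (y \<bullet> (e \<times> x))" for x
    by (simp add: dot_cross dot_cross_self inner_commute)
  have ev: "\<forall>\<^sub>F t in nhds 0. vec_angle (perp_part (e + t *\<^sub>R y) p) (perp_part (e + t *\<^sub>R y) q)
     = vec_angle (e \<times> p + t *\<^sub>R (y \<times> p)) (e \<times> q + t *\<^sub>R (y \<times> q))"
    using eventually_line_ne_0[OF e, of y]
    by eventually_elim (simp add: vec_angle_perp_part cross_add_scaleR_left)
  show ?thesis
    unfolding DERIV_cong_ev[OF refl ev refl]
    using dihedral_line_derivative[OF D, of "y \<times> p" "y \<times> q"] by (simp add: *)
qed

section \<open>Nondegenerate tetrahedra and their oriented volume\<close>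

lemma independent_triple_iff:
  fixes a b x :: "real^3"
  shows "(a \<times> b) \<bullet> x \<noteq> 0 \<longleftrightarrow> independent {a, b, x} \<and> distinct [a, b, x]"
proof
  assume D: "(a \<times> b) \<bullet> x \<noteq> 0"
  have "(a \<times> b) \<bullet> y = 0" if "y \<in> span {a, b}" for y
    using that
    by (induction rule: span_induct_alt) (auto simp: inner_add_right dot_cross_self)
  then have x: "x \<notin> span {a, b}" using D by auto
  have "a \<times> y = 0" if "y \<in> span {a}" for y
    using that by (induction rule: span_induct_alt) (auto simp: cross_add_right cross_mult_right)
  then have b: "b \<notin> span {a}" using D by auto
  have "a \<noteq> 0" using D by auto
  then have "independent {a}" by simp
  then have "independent {a, b}"
    using independent_insertI[OF b] by (simp add: insert_commute)
  then have "independent {a, b, x}"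
    using independent_insertI[OF x] by (simp add: insert_commute)
  moreover have "distinct [a, b, x]"
    using D x b by (auto simp: dot_cross_self span_base)
  ultimately show "independent {a, b, x} \<and> distinct [a, b, x]" by blast
next
  assume *: "independent {a, b, x} \<and> distinct [a, b, x]"
  show "(a \<times> b) \<bullet> x \<noteq> 0"
  proof
    assume D: "(a \<times> b) \<bullet> x = 0"
    have "UNIV \<subseteq> span {a, b, x}"
      by (rule card_ge_dim_independent) (use * in auto)
    moreover have "(a \<times> b) \<bullet> y = 0" if "y \<in> span {a, b, x}" for y
      using that
      by (induction rule: span_induct_alt) (auto simp: inner_add_right dot_cross_self D)
    ultimately have "(a \<times> b) \<bullet> (a \<times> b) = 0" by blast
    moreover have "a \<noteq> 0" "b \<noteq> 0"
      using * dependent_zero[of "{a, b, x}"] by auto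
    ultimately have "collinear {0, a, b}" by (simp add: cross_eq_0)
    then obtain c where c: "b = c *\<^sub>R a"
      using \<open>a \<noteq> 0\<close> \<open>b \<noteq> 0\<close> by (auto simp: collinear_lemma)
    then have "b \<in> span {a}" by (simp add: span_base span_scale)
    moreover have "independent {b, a}"
      using * independent_mono[of "{a, b, x}" "{b, a}"] by auto
    ultimately show False using * independent_insert[of b "{a}"] by auto
  qed
qed

text \<open>
  Six times the oriented volume of the tetrahedron; it is polynomial in the vertices, which makes
  nondegeneracy an open condition.
\<close>

definition tet_det :: "('a \<Rightarrow> real^3) \<Rightarrow> 'a \<Rightarrow> 'a \<Rightarrow> 'a \<Rightarrow> 'a \<Rightarrow> real" where
  "tet_det v i j k l = ((v j - v i) \<times> (v k - v i)) \<bullet> (v l - v i)"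

lemma UNIV_vertices:
  assumes "distinct [i, j, k, l :: 4]"
  shows "UNIV = {i, j, k, l}"
proof -
  have "card {i, j, k, l} = CARD(4)" using assms by simp
  then show ?thesis by (metis card_subset_eq finite subset_UNIV)
qed

lemma nondegenerate_iff_tet_det:
  assumes "distinct [i, j, k, l :: 4]"
  shows "inj v \<and> \<not> affine_dependent (range v) \<longleftrightarrow> tet_det v i j k l \<noteq> 0"
proof -
  have U: "UNIV = {i, j, k, l}" by (rule UNIV_vertices[OF assms])
  have rng: "range v = {v i, v j, v k, v l}"
    unfolding U by simp
  have img: "(\<lambda>x. - v i + x) ` (range v - {v i}) = {v j - v i, v k - v i, v l - v i}" if "inj v"
    using that assms unfolding rng by (auto simp: inj_eq)
  have "inj_on v {i, j, k, l} \<longleftrightarrow> distinct [v i, v j, v k, v l]"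
    using assms by auto
  then have inj: "inj v \<longleftrightarrow> distinct [v i, v j, v k, v l]"
    unfolding U .
  show ?thesis
  proof
    assume *: "inj v \<and> \<not> affine_dependent (range v)"
    then have "independent {v j - v i, v k - v i, v l - v i}"
      using affine_dependent_iff_dependent2[of "v i" "range v"] img by simp
    moreover have "distinct [v j - v i, v k - v i, v l - v i]"
      using * inj by simp
    ultimately show "tet_det v i j k l \<noteq> 0"
      unfolding tet_det_def independent_triple_iff by blast
  next
    assume D: "tet_det v i j k l \<noteq> 0"
    then have ind: "independent {v j - v i, v k - v i, v l - v i}"
      "distinct [v j - v i, v k - v i, v l - v i]"
      unfolding tet_det_def independent_triple_iff by blast+
    have "v j \<noteq> v i" "v k \<noteq> v i" "v l \<noteq> v i"
      using D by (auto simp: tet_det_def)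
    then have "inj v" using ind(2) inj by auto
    moreover have "\<not> affine_dependent (range v)"
      using affine_dependent_iff_dependent2[of "v i" "range v"] img[OF \<open>inj v\<close>] ind(1) by simp
    ultimately show "inj v \<and> \<not> affine_dependent (range v)" by blast
  qed
qed

lemma realizes_iff_tet_det:
  assumes "distinct [i, j, k, l]"
  shows "realizes L v \<longleftrightarrow> tet_det v i j k l \<noteq> 0 \<and> (\<forall>a b. a \<noteq> b \<longrightarrow> dist (v a) (v b) = L $ edge a b)"
  using nondegenerate_iff_tet_det[OF assms, of v] by (auto simp: realizes_def)

section \<open>The center of a metric\<close>

text \<open>
  The cross products of the pairs, divided by the triple product, form the dual basis.
\<close>

lemma exists_vector_with_inner_products:
  fixes a b x :: "real^3"
  assumes "(a \<times> b) \<bullet> x \<noteq> 0"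
  obtains c where "c \<bullet> a = \<alpha>" "c \<bullet> b = \<beta>" "c \<bullet> x = \<xi>"
proof -
  define D where "D = (a \<times> b) \<bullet> x"
  have D: "D \<noteq> 0" "(b \<times> x) \<bullet> a = D" "(x \<times> a) \<bullet> b = D" "(a \<times> b) \<bullet> x = D"
    using assms by (simp_all add: D_def) (metis cross_triple)+
  show thesis
    by (rule that[of "(1 / D) *\<^sub>R (\<alpha> *\<^sub>R (b \<times> x) + \<beta> *\<^sub>R (x \<times> a) + \<xi> *\<^sub>R (a \<times> b))"])
       (simp_all add: inner_add_left D dot_cross_self)
qed

text \<open>
  The point \<open>c\<close> projects orthogonally to the points of the edge lines that are prescribed by \<open>d\<close>.
\<close>

definition is_center :: "(4 \<Rightarrow> 4 \<Rightarrow> real) \<Rightarrow> (4 \<Rightarrow> real^3) \<Rightarrow> real^3 \<Rightarrow> bool" where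
  "is_center d v c \<longleftrightarrow> (\<forall>i j. i \<noteq> j \<longrightarrow> (c - v i) \<bullet> (v j - v i) = d i j * norm (v j - v i))"

text \<open>
  The three edges at one vertex determine a candidate \<open>c\<close>. By polarization, the condition for an edge
  \<open>{i, j}\<close> says that the squared distances of \<open>c\<close> from the two endpoints differ by
  \<open>(d i j)\<^sup>2 - (d j i)\<^sup>2\<close>. The condition of a tetrahedron metric on a face states precisely that these differences add
  up to zero around the face, which carries the property over to the remaining edges.
\<close>

lemma exists_center:
  assumes d: "tetrahedron_metric d" and v: "realizes (edge_lengths d) v"
  obtains c where "is_center d v c"
proof -
  have len: "norm (v j - v i) = d i j + d j i" if "i \<noteq> j" for i j
    using v that unfolding realizes_def
    by (metis dist_commute dist_norm edge_lengths_edge)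
  have "tet_det v 1 2 3 4 \<noteq> 0"
    using v realizes_iff_tet_det[of 1 2 3 4] by simp
  then obtain c' :: "real^3" where c': "c' \<bullet> (v 2 - v 1) = d 1 2 * norm (v 2 - v 1)"
      "c' \<bullet> (v 3 - v 1) = d 1 3 * norm (v 3 - v 1)" "c' \<bullet> (v 4 - v 1) = d 1 4 * norm (v 4 - v 1)"
    unfolding tet_det_def by (rule exists_vector_with_inner_products)
  define c where "c = c' + v 1"
  have base: "(c - v 1) \<bullet> (v j - v 1) = d 1 j * norm (v j - v 1)" if "j \<noteq> 1" for j
    using exhaust_4[of j] that c' by (auto simp: c_def)
  \<comment> \<open>the squared distances from \<open>c\<close>, a potential whose differences along the edges \<open>d\<close> prescribes\<close>
  define g where "g i = (norm (c - v i))\<^sup>2" for i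
  have polar: "2 * ((c - v i) \<bullet> (v j - v i)) = g i - g j + (norm (v j - v i))\<^sup>2" for i j
    by (simp add: g_def power2_norm_eq_inner inner_diff_left inner_diff_right inner_commute)
  have iff: "(c - v i) \<bullet> (v j - v i) = d i j * norm (v j - v i) \<longleftrightarrow> g i - g j = (d i j)\<^sup>2 - (d j i)\<^sup>2"
    if "i \<noteq> j" for i j
    using polar[of i j] unfolding len[OF that] by (auto simp: power2_eq_square algebra_simps)
  have g1: "g 1 - g j = (d 1 j)\<^sup>2 - (d j 1)\<^sup>2" if "j \<noteq> 1" for j
    using base[OF that] iff[of 1 j] that by simp
  have "g i - g j = (d i j)\<^sup>2 - (d j i)\<^sup>2" if "i \<noteq> j" for i j
  proof (cases "i = 1 \<or> j = 1")
    case True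
    then show ?thesis using g1[of i] g1[of j] that by auto
  next
    case False
    then have "(d i j)\<^sup>2 + (d j 1)\<^sup>2 + (d 1 i)\<^sup>2 = (d j i)\<^sup>2 + (d i 1)\<^sup>2 + (d 1 j)\<^sup>2"
      using d that unfolding tetrahedron_metric_def by auto
    then show ?thesis using g1[of i] g1[of j] False by simp
  qed
  then have "is_center d v c"
    unfolding is_center_def using iff by blast
  then show thesis by (rule that)
qed

text \<open>
  With \<open>c\<close> at hand, the distance from the face center to an edge is the component of \<open>c - v i\<close>
  along the in-plane normal of the edge. Writing it with cross products avoids naming that normal.
\<close>

lemma h_edge_center:
  assumes v: "realizes (edge_lengths d) v" and c: "is_center d v c" and ijk: "distinct [i, j, k]"
    and nc: "(v j - v i) \<times> (v k - v i) \<noteq> 0"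
  shows "h_edge d i j k = ((v j - v i) \<times> (v k - v i)) \<bullet> ((v j - v i) \<times> (c - v i))
    / (norm (v j - v i) * norm ((v j - v i) \<times> (v k - v i)))"
proof -
  define e where "e = v j - v i"
  define a where "a = v k - v i"
  have nz: "e \<noteq> 0" "a \<noteq> 0" "e \<times> a \<noteq> 0" using nc by (auto simp: e_def a_def)
  have d: "(c - v i) \<bullet> e = d i j * norm e" "(c - v i) \<bullet> a = d i k * norm a"
    using c ijk by (auto simp: is_center_def e_def a_def)
  have "h_edge d i j k = (d i k - d i j * ((e \<bullet> a) / (norm e * norm a))) / (norm (e \<times> a) / (norm e * norm a))"
    unfolding h_edge_def Let_def face_angle_eq[OF v] e_def[symmetric] a_def[symmetric]
    using nz by (simp add: cos_vec_angle sin_vec_angle)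
  also have "\<dots> = (norm e ^ 2 * (d i k * norm a) - (d i j * norm e) * (e \<bullet> a)) / (norm e * norm (e \<times> a))"
    using nz by (simp add: field_simps power2_eq_square)
  also have "norm e ^ 2 * (d i k * norm a) - (d i j * norm e) * (e \<bullet> a) = (e \<times> a) \<bullet> (e \<times> (c - v i))"
    unfolding d[symmetric] by (simp add: dot_cross power2_norm_eq_inner inner_commute)
  finally show ?thesis by (simp add: e_def a_def)
qed

text \<open>
  The signed distance of \<open>c\<close> from a face is a component along the face normal; the sign of the volume
  chooses the normal that points towards the fourth vertex.
\<close>

lemma h_face_center:
  assumes v: "realizes (edge_lengths d) v" and c: "is_center d v c" and ijkl: "distinct [i, j, k, l]"
  shows "h_face d i j k l = sgn (tet_det v i j k l) *
    (((v j - v i) \<times> (v k - v i)) \<bullet> (c - v i)) / norm ((v j - v i) \<times> (v k - v i))"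
proof -
  define e where "e = v j - v i"
  define u where "u = e \<times> (v k - v i)"
  define w where "w = e \<times> (v l - v i)"
  define z where "z = e \<times> (c - v i)"
  define D where "D = tet_det v i j k l"
  have D: "D \<noteq> 0" using v realizes_iff_tet_det[OF ijkl] D_def by simp
  have uw: "u \<times> w = D *\<^sub>R e"
    by (simp add: u_def w_def D_def tet_det_def e_def cross_cross_common)
  have e: "e \<noteq> 0" using D by (auto simp: D_def tet_det_def e_def)
  have nz: "u \<noteq> 0" "w \<noteq> 0" using uw D e by auto
  have h: "h_edge d i j k = (u \<bullet> z) / (norm e * norm u)" "h_edge d i j l = (w \<bullet> z) / (norm e * norm w)"
    using h_edge_center[OF v c] ijkl nz by (auto simp: e_def u_def w_def z_def)
  have "vec_angle (perp_part e (v k - v i)) (perp_part e (v l - v i)) = vec_angle u w"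
    using e by (simp add: vec_angle_perp_part u_def w_def)
  then have "h_face d i j k l = ((w \<bullet> z) / (norm e * norm w) - (u \<bullet> z) / (norm e * norm u) * ((u \<bullet> w) / (norm u * norm w)))
     / (\<bar>D\<bar> * norm e / (norm u * norm w))"
    unfolding h_face_def Let_def dihedral_angle_eq[OF v] e_def[symmetric] h
    using nz by (simp add: cos_vec_angle sin_vec_angle uw)
  also have "\<dots> = ((norm u)\<^sup>2 * (w \<bullet> z) - (u \<bullet> w) * (u \<bullet> z)) / (\<bar>D\<bar> * (norm e)\<^sup>2 * norm u)"
    using nz e D by (simp add: divide_simps power2_eq_square)
  also have "(norm u)\<^sup>2 * (w \<bullet> z) - (u \<bullet> w) * (u \<bullet> z) = - (u \<times> (u \<times> w)) \<bullet> z"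
    by (simp add: Lagrange power2_norm_eq_inner inner_diff_left)
  also have "\<dots> = D * ((norm e)\<^sup>2 * (u \<bullet> (c - v i)))"
    unfolding uw by (simp add: z_def u_def cross_mult_right dot_cross dot_cross_self power2_norm_eq_inner)
  also have "D * ((norm e)\<^sup>2 * (u \<bullet> (c - v i))) / (\<bar>D\<bar> * (norm e)\<^sup>2 * norm u) = sgn D * (u \<bullet> (c - v i)) / norm u"
    using D e by (cases "D > 0") auto
  finally show ?thesis by (simp add: u_def e_def D_def)
qed

section \<open>Realizable edge lengths form an open set, and dihedral angles are differentiable\<close>

text \<open>
  Cholesky factorization: the vectors are the rows of the triangular factor. The last
  hypothesis is positivity of the Gram determinant, multiplied by \<open>A\<close>.
\<close>

lemma exists_vectors_with_gram_matrix:
  fixes A B C F H K :: real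
  assumes A: "A > 0" and E: "A * C - B\<^sup>2 > 0"
    and G: "(A * C - B\<^sup>2) * (A * K - F\<^sup>2) - (A * H - B * F)\<^sup>2 > 0"
  obtains a b x :: "real^3" where
    "a \<bullet> a = A" "a \<bullet> b = B" "b \<bullet> b = C" "a \<bullet> x = F" "b \<bullet> x = H" "x \<bullet> x = K" "(a \<times> b) \<bullet> x \<noteq> 0"
proof -
  define E where "E = A * C - B\<^sup>2"
  define W where "W = A * H - B * F"
  define p where "p = sqrt A"
  define q where "q = sqrt E"
  define r where "r = sqrt (E * (A * K - F\<^sup>2) - W\<^sup>2)"
  have pos: "p > 0" "q > 0" "r > 0"
    using assms by (simp_all add: p_def q_def r_def E_def W_def)
  have sq: "p\<^sup>2 = A" "q\<^sup>2 = E" "r\<^sup>2 = E * (A * K - F\<^sup>2) - W\<^sup>2"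
    using assms by (simp_all add: p_def q_def r_def E_def W_def)
  define a :: "real^3" where "a = vector [p, 0, 0]"
  define b :: "real^3" where "b = vector [B / p, q / p, 0]"
  define x :: "real^3" where "x = vector [F / p, W / (p * q), r / (p * q)]"
  have nz: "A \<noteq> 0" "E \<noteq> 0" using assms by (auto simp: E_def)
  have inner3: "vector [s1, s2, s3] \<bullet> (vector [t1, t2, t3] :: real^3) = s1 * t1 + s2 * t2 + s3 * t3"
    for s1 s2 s3 t1 t2 t3 :: real
    by (simp add: inner_vec_def sum_3)
  show thesis
  proof
    show "a \<bullet> a = A" using sq by (simp add: a_def inner3 power2_eq_square)
    show "a \<bullet> b = B" "a \<bullet> x = F" using pos by (simp_all add: a_def b_def x_def inner3)
    have "b \<bullet> b = (B\<^sup>2 + q\<^sup>2) / p\<^sup>2"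
      by (simp add: b_def inner3 power2_eq_square add_divide_distrib)
    then show "b \<bullet> b = C" unfolding sq using nz by (simp add: E_def)
    have "b \<bullet> x = (B * F + W) / p\<^sup>2"
      using pos by (simp add: b_def x_def inner3 power2_eq_square add_divide_distrib)
    then show "b \<bullet> x = H" unfolding sq using nz by (simp add: W_def)
    have "x \<bullet> x = F\<^sup>2 / p\<^sup>2 + (W\<^sup>2 + r\<^sup>2) / (p\<^sup>2 * q\<^sup>2)"
      by (simp add: x_def inner3 power2_eq_square add_divide_distrib mult_ac)
    also have "\<dots> = F\<^sup>2 / A + (A * K - F\<^sup>2) / A"
      unfolding sq using nz by simp
    also have "\<dots> = K" using nz by (simp add: diff_divide_distrib)
    finally show "x \<bullet> x = K" .
    have "(a \<times> b) \<bullet> x = p * (q / p) * (r / (p * q))"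
      by (simp add: a_def b_def x_def cross3_def inner3)
    then show "(a \<times> b) \<bullet> x \<noteq> 0" using pos by simp
  qed
qed

text \<open>
  The inner product of the edge vectors from \<open>i\<close> to \<open>j\<close> and \<open>k\<close>, by the law of cosines. The case
  \<open>j = k\<close> is separate because \<open>edge j j\<close> is an arbitrary edge.
\<close>

definition gram :: "real^edge \<Rightarrow> 4 \<Rightarrow> 4 \<Rightarrow> 4 \<Rightarrow> real" where
  "gram L i j k = ((L $ edge i j)\<^sup>2 + (L $ edge i k)\<^sup>2 - (if j = k then 0 else (L $ edge j k)\<^sup>2)) / 2"

lemma gram_realizes:
  assumes "realizes L v" "i \<noteq> j" "i \<noteq> k"
  shows "(v j - v i) \<bullet> (v k - v i) = gram L i j k"
proof -
  have d: "norm (v a - v b) = L $ edge a b" if "a \<noteq> b" for a b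
    using assms(1) that by (auto simp: realizes_def dist_norm)
  show ?thesis
    using dot_norm_neg[of "v j - v i" "v k - v i"] assms(2,3) d
    by (auto simp: gram_def edge_commute)
qed

lemma gram_differentiable: "(\<lambda>L. gram L i j k) differentiable (at L)"
proof -
  have nth: "(\<lambda>L. L $ e) differentiable (at L)" for e and L :: "real^edge"
    by (rule bounded_linear_imp_differentiable) (rule bounded_linear_vec_nth)
  show ?thesis
    unfolding gram_def
    by (cases "j = k", simp_all only: if_True if_False)
       (intro differentiable_divide differentiable_diff differentiable_add differentiable_power
          differentiable_const nth; simp)+
qed

text \<open>
  Realizability amounts to positivity of the edge lengths and of three polynomials in them, the leading minors of the Gram
  matrix up to positive factors; all of these persist under small changes of the lengths.
\<close>

lemma eventually_realizable:
  assumes v: "realizes L v"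
  shows "\<forall>\<^sub>F L' in nhds L. \<exists>w. realizes L' w"
proof -
  define A where "A L = gram L 1 2 2" for L
  define B where "B L = gram L 1 2 3" for L
  define C where "C L = gram L 1 3 3" for L
  define F where "F L = gram L 1 2 4" for L
  define H where "H L = gram L 1 3 4" for L
  define K where "K L = gram L 1 4 4" for L
  note defs = A_def B_def C_def F_def H_def K_def
  define E where "E L = A L * C L - (B L)\<^sup>2" for L
  define G where "G L = E L * (A L * K L - (F L)\<^sup>2) - (A L * H L - B L * F L)\<^sup>2" for L
  define a where "a = v 2 - v 1"
  define b where "b = v 3 - v 1"
  define x where "x = v 4 - v 1"
  have g: "a \<bullet> a = A L" "a \<bullet> b = B L" "b \<bullet> b = C L" "a \<bullet> x = F L" "b \<bullet> x = H L" "x \<bullet> x = K L"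
    using gram_realizes[OF v] by (simp_all add: defs a_def b_def x_def)
  have D: "(a \<times> b) \<bullet> x \<noteq> 0"
    using v realizes_iff_tet_det[of 1 2 3 4] by (simp add: tet_det_def a_def b_def x_def)
  have "a \<noteq> 0" "a \<times> b \<noteq> 0" using D by auto
  have A: "A L > 0" using \<open>a \<noteq> 0\<close> g(1) by (metis inner_gt_zero_iff)
  have "E L = (a \<times> b) \<bullet> (a \<times> b)"
    unfolding E_def g[symmetric] by (simp add: dot_cross power2_eq_square inner_commute)
  then have E: "E L > 0" using \<open>a \<times> b \<noteq> 0\<close> by simp
  have "G L = (norm ((a \<times> b) \<times> (a \<times> x)))\<^sup>2"
    unfolding G_def E_def g[symmetric] norm_cross power2_norm_eq_inner
    by (simp add: dot_cross power2_eq_square inner_commute mult.commute)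
  moreover have "(a \<times> b) \<times> (a \<times> x) \<noteq> 0"
    unfolding cross_cross_common using D \<open>a \<noteq> 0\<close> by simp
  ultimately have G: "G L > 0" by simp
  have cont: "isCont (\<lambda>L. gram L i j k) L" for i j k
    using gram_differentiable differentiable_imp_continuous_within by blast
  have cont: "isCont A L" "isCont E L" "isCont G L" "isCont (\<lambda>L. L $ e) L" for e
    unfolding G_def[abs_def] E_def[abs_def] defs[abs_def] by (intro continuous_intros cont)+
  have ev: "\<forall>\<^sub>F L' in nhds L. f L' > 0" if "isCont f L" "f L > 0" for f :: "real^edge \<Rightarrow> real"
    using that order_tendstoD(1)[of f "f L" "nhds L" 0]
    by (simp add: isCont_def tendsto_at_iff_tendsto_nhds)
  have Lpos: "L $ e > 0" if "e = edge i j" "i \<noteq> j" for e i j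
    using v that unfolding realizes_def inj_def by (metis zero_less_dist_iff)
  have evL: "\<forall>\<^sub>F L' in nhds L. L' $ edge i j > 0" if "i \<noteq> j" for i j
    by (rule ev) (use cont Lpos that in auto)
  have evL: "\<forall>\<^sub>F L' in nhds L. \<forall>i j. i \<noteq> j \<longrightarrow> L' $ edge i j > 0"
  proof (intro eventually_all_finite)
    show "\<forall>\<^sub>F L' in nhds L. i \<noteq> j \<longrightarrow> L' $ edge i j > 0" for i j
      using evL[of i j] by (cases "i = j") simp_all
  qed
  show ?thesis
    using ev[OF cont(1) A] ev[OF cont(2) E] ev[OF cont(3) G] evL
  proof eventually_elim
    case (elim L')
    obtain a b x :: "real^3" where w:
      "a \<bullet> a = A L'" "a \<bullet> b = B L'" "b \<bullet> b = C L'" "a \<bullet> x = F L'" "b \<bullet> x = H L'" "x \<bullet> x = K L'"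
      "(a \<times> b) \<bullet> x \<noteq> 0"
      using exists_vectors_with_gram_matrix[of "A L'" "C L'" "B L'" "K L'" "F L'" "H L'"] elim
      unfolding G_def E_def by metis
    define w where "w i = (if i = 2 then a else if i = 3 then b else if i = 4 then x else 0)" for i :: 4
    have dd: "(norm (y - z))\<^sup>2 = y \<bullet> y + z \<bullet> z - 2 * (y \<bullet> z)" for y z :: "real^3"
      by (simp add: power2_norm_eq_inner inner_diff_left inner_diff_right inner_commute)
    have sq: "(norm a)\<^sup>2 = (L' $ edge 1 2)\<^sup>2" "(norm b)\<^sup>2 = (L' $ edge 1 3)\<^sup>2"
      "(norm x)\<^sup>2 = (L' $ edge 1 4)\<^sup>2" "(norm (a - b))\<^sup>2 = (L' $ edge 2 3)\<^sup>2"
      "(norm (a - x))\<^sup>2 = (L' $ edge 2 4)\<^sup>2" "(norm (b - x))\<^sup>2 = (L' $ edge 3 4)\<^sup>2"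
      unfolding dd unfolding power2_norm_eq_inner w defs gram_def by (simp_all add: field_simps)
    have root: "norm y = L' $ edge i j" if "(norm y)\<^sup>2 = (L' $ edge i j)\<^sup>2" "i \<noteq> j" for y :: "real^3" and i j
      using that elim(4) by (metis less_imp_le norm_ge_zero power2_eq_imp_eq)
    have len: "norm a = L' $ edge 1 2" "norm b = L' $ edge 1 3" "norm x = L' $ edge 1 4"
      "norm (a - b) = L' $ edge 2 3" "norm (a - x) = L' $ edge 2 4" "norm (b - x) = L' $ edge 3 4"
      using root[OF sq(1)] root[OF sq(2)] root[OF sq(3)] root[OF sq(4)] root[OF sq(5)] root[OF sq(6)] by simp_all
    have "\<forall>i j. i \<noteq> j \<longrightarrow> dist (w i) (w j) = L' $ edge i j"
      unfolding forall_4
      by (simp add: w_def dist_norm len norm_minus_commute[of b a] norm_minus_commute[of x a]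
          norm_minus_commute[of x b] edge_commute[of 2 1] edge_commute[of 3 1] edge_commute[of 4 1]
          edge_commute[of 3 2] edge_commute[of 4 2] edge_commute[of 4 3])
    then have "realizes L' w"
      using w(7) realizes_iff_tet_det[of 1 2 3 4] by (simp add: tet_det_def w_def)
    then show ?case by blast
  qed
qed

text \<open>
  The inner product of the normals of the faces \<open>{i, j, k}\<close> and \<open>{i, j, l}\<close>, as a polynomial in the
  edge lengths.
\<close>

definition cross_gram :: "real^edge \<Rightarrow> 4 \<Rightarrow> 4 \<Rightarrow> 4 \<Rightarrow> 4 \<Rightarrow> real" where
  "cross_gram L i j k l = gram L i j j * gram L i k l - gram L i j l * gram L i k j"

lemma dihedral_angle_cross_gram:
  assumes v: "realizes L v" and ijkl: "distinct [i, j, k, l]"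
  shows "dihedral_angle L i j k l =
    arccos (cross_gram L i j k l / (sqrt (cross_gram L i j k k) * sqrt (cross_gram L i j l l)))"
    and "(cross_gram L i j k l)\<^sup>2 < cross_gram L i j k k * cross_gram L i j l l"
    and "cross_gram L i j k k > 0"
proof -
  define e where "e = v j - v i"
  define u where "u = e \<times> (v k - v i)"
  define w where "w = e \<times> (v l - v i)"
  have D: "(e \<times> (v k - v i)) \<bullet> (v l - v i) \<noteq> 0"
    using v realizes_iff_tet_det[OF ijkl] by (simp add: tet_det_def e_def)
  then have nz: "e \<noteq> 0" "u \<noteq> 0" by (auto simp: u_def)
  have "u \<times> w \<noteq> 0"
    using D nz by (simp add: u_def w_def cross_cross_common)
  have g: "u \<bullet> w = cross_gram L i j k l" "u \<bullet> u = cross_gram L i j k k" "w \<bullet> w = cross_gram L i j l l"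
    using ijkl gram_realizes[OF v] by (simp_all add: cross_gram_def u_def w_def e_def dot_cross)
  show "dihedral_angle L i j k l =
    arccos (cross_gram L i j k l / (sqrt (cross_gram L i j k k) * sqrt (cross_gram L i j l l)))"
    unfolding dihedral_angle_eq[OF v] e_def[symmetric] vec_angle_perp_part[OF nz(1)]
    unfolding u_def[symmetric] w_def[symmetric]
    by (simp add: vec_angle_def norm_eq_sqrt_inner g)
  have "(norm (u \<times> w))\<^sup>2 > 0" using \<open>u \<times> w \<noteq> 0\<close> by simp
  then show "(cross_gram L i j k l)\<^sup>2 < cross_gram L i j k k * cross_gram L i j l l"
    unfolding norm_cross unfolding power2_norm_eq_inner g by simp
  show "cross_gram L i j k k > 0"
    using nz by (simp flip: g)
qed

lemma differentiable_real_compose: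
  fixes f :: "'a::real_normed_vector \<Rightarrow> real" and g :: "real \<Rightarrow> real"
  assumes "(g has_real_derivative g') (at (f x))" "f differentiable (at x)"
  shows "(\<lambda>x. g (f x)) differentiable (at x)"
  using assms differentiable_chain_at[of f x g]
  by (auto simp: o_def differentiable_def has_field_derivative_def)

text \<open>
  Realizability in a whole neighbourhood is essential: it turns the angle, which is defined through a
  chosen realization, into an explicit function of the lengths near \<open>L\<close>. Nondegeneracy keeps the argument of
  \<open>arccos\<close> away from the endpoints \<open>-1\<close> and \<open>1\<close>.
\<close>

lemma dihedral_angle_differentiable:
  assumes v: "realizes L v" and ijkl: "distinct [i, j, k, l]"
  shows "(\<lambda>L. dihedral_angle L i j k l) differentiable (at L)"
proof -
  define P where "P L = cross_gram L i j k l" for L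
  define Q where "Q L = cross_gram L i j k k" for L
  define R where "R L = cross_gram L i j l l" for L
  have ijlk: "distinct [i, j, l, k]" using ijkl by auto
  have diff: "(\<lambda>L. cross_gram L i j k l) differentiable (at L)" for k l
    unfolding cross_gram_def
    by (intro differentiable_diff differentiable_mult gram_differentiable)
  have pos: "(P L)\<^sup>2 < Q L * R L" "Q L > 0" "R L > 0"
    using dihedral_angle_cross_gram[OF v ijkl] dihedral_angle_cross_gram[OF v ijlk]
    by (simp_all add: P_def Q_def R_def)
  define z where "z L = P L / (sqrt (Q L) * sqrt (R L))" for L
  have diffs: "P differentiable (at L)" "Q differentiable (at L)" "R differentiable (at L)"
    unfolding P_def[abs_def] Q_def[abs_def] R_def[abs_def] by (rule diff)+
  have z: "z differentiable (at L)"
    unfolding z_def[abs_def]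
  proof (intro differentiable_divide differentiable_mult diffs(1))
    show "(\<lambda>L. sqrt (Q L)) differentiable (at L)"
      by (rule differentiable_real_compose[OF DERIV_real_sqrt[OF pos(2)] diffs(2)])
    show "(\<lambda>L. sqrt (R L)) differentiable (at L)"
      by (rule differentiable_real_compose[OF DERIV_real_sqrt[OF pos(3)] diffs(3)])
    show "sqrt (Q L) * sqrt (R L) \<noteq> 0"
      using pos by simp
  qed
  have "(z L)\<^sup>2 < 1"
    using pos by (simp add: z_def power_divide power_mult_distrib)
  then have bounds: "-1 < z L" "z L < 1"
    by (simp_all add: abs_square_less_1 abs_less_iff)
  have "(\<lambda>L. arccos (z L)) differentiable (at L)"
    by (rule differentiable_real_compose[OF DERIV_arccos[OF bounds] z])
  then obtain D where D: "((\<lambda>L. arccos (z L)) has_derivative D) (at L)"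
    by (auto simp: differentiable_def)
  have ev: "\<forall>\<^sub>F L' in nhds L. arccos (z L') = dihedral_angle L' i j k l"
    using eventually_realizable[OF v]
    by eventually_elim (auto simp: dihedral_angle_cross_gram(1)[OF _ ijkl] z_def P_def Q_def R_def)
  have "((\<lambda>L. dihedral_angle L i j k l) has_derivative D) (at L)"
    by (rule has_derivative_transform_eventually[OF D])
      (use ev eventually_nhds_x_imp_x[OF ev] in \<open>simp_all add: eventually_nhds_conv_at\<close>)
  then show ?thesis by (auto simp: differentiable_def)
qed

section \<open>Length variations that come from moving one vertex\<close>

lemma edge_cases:
  obtains i j where "i \<noteq> j" "e = edge i j"
proof -
  have "card (Rep_edge e) = 2" using Rep_edge[of e] by simp
  then obtain i j where "Rep_edge e = {i, j}" "i \<noteq> j" by (auto simp: card_2_iff)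
  then show thesis using that[of i j] by (simp add: edge_def flip: \<open>Rep_edge e = {i, j}\<close> add: Rep_edge_inverse)
qed

definition move_vertex :: "('a \<Rightarrow> real^3) \<Rightarrow> 'a \<Rightarrow> real^3 \<Rightarrow> real \<Rightarrow> 'a \<Rightarrow> real^3" where
  "move_vertex v l y t = v(l := v l + t *\<^sub>R y)"

text \<open>
  The variation \<open>\<delta>L\<close> of the edge lengths is the one caused by moving the vertex \<open>l\<close> with velocity \<open>y\<close>.
\<close>

definition length_velocity :: "(4 \<Rightarrow> real^3) \<Rightarrow> 4 \<Rightarrow> real^3 \<Rightarrow> real^edge \<Rightarrow> bool" where
  "length_velocity v l y \<delta>L \<longleftrightarrow>
     (\<forall>i j. i \<noteq> j \<longrightarrow> i \<noteq> l \<longrightarrow> j \<noteq> l \<longrightarrow> \<delta>L $ edge i j = 0) \<and>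
     (\<forall>i. i \<noteq> l \<longrightarrow> \<delta>L $ edge i l = y \<bullet> (v l - v i) / norm (v l - v i))"

text \<open>
  By the chain rule, the Frechet derivative in the direction \<open>\<delta>L\<close> may be computed along any curve of lengths with
  velocity \<open>\<delta>L\<close>; the curve traced by the moving tetrahedron has the advantage that its
  dihedral angles are known.
\<close>

lemma dihedral_variation_move_vertex:
  assumes v: "realizes L v" and ijkl: "distinct [i, j, k, l]" and pqrs: "distinct [p, q, r, s]"
    and \<delta>L: "length_velocity v l y \<delta>L"
    and B: "((\<lambda>t. let m = move_vertex v l y t in
         vec_angle (perp_part (m q - m p) (m r - m p)) (perp_part (m q - m p) (m s - m p)))
       has_real_derivative B) (at 0)"
  shows "dihedral_variation L \<delta>L p q r s = B"
proof -
  define m where "m = move_vertex v l y"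
  \<comment> \<open>each length is split evenly between the two orientations of the edge\<close>
  define \<Lambda> where "\<Lambda> t = edge_lengths (\<lambda>i j. dist (m t i) (m t j) / 2)" for t
  have \<Lambda>: "\<Lambda> t $ edge i j = dist (m t i) (m t j)" if "i \<noteq> j" for t i j
    using that by (simp add: \<Lambda>_def edge_lengths_edge dist_commute)
  have m0: "m 0 = v" by (simp add: m_def move_vertex_def)
  have \<Lambda>0: "\<Lambda> 0 = L"
    unfolding vec_eq_iff
  proof
    fix e show "\<Lambda> 0 $ e = L $ e"
      using v by (cases e rule: edge_cases) (simp add: \<Lambda> m0 realizes_def)
  qed
  have dist_l: "((\<lambda>t. dist (m t i) (m t l)) has_real_derivative \<delta>L $ edge i l) (at 0)" if "i \<noteq> l" for i
  proof -
    define x where "x = v l - v i"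
    have "x \<noteq> 0" using v that by (auto simp: realizes_def inj_eq x_def)
    have "((\<lambda>t. x \<bullet> x + t * (2 * (x \<bullet> y)) + t\<^sup>2 * (y \<bullet> y)) has_real_derivative 2 * (x \<bullet> y)) (at 0)"
      by (rule derivative_eq_intros refl | simp)+
    moreover have "x \<bullet> x + t * (2 * (x \<bullet> y)) + t\<^sup>2 * (y \<bullet> y) = (x + t *\<^sub>R y) \<bullet> (x + t *\<^sub>R y)" for t
      by (simp add: inner_add_left inner_add_right inner_commute power2_eq_square)
    ultimately have q: "((\<lambda>t. (x + t *\<^sub>R y) \<bullet> (x + t *\<^sub>R y)) has_real_derivative 2 * (x \<bullet> y)) (at 0)"
      by simp
    then have "((\<lambda>t. sqrt ((x + t *\<^sub>R y) \<bullet> (x + t *\<^sub>R y))) has_real_derivative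
        inverse (sqrt (x \<bullet> x)) / 2 * (2 * (x \<bullet> y))) (at 0)"
      using DERIV_chain2[OF DERIV_real_sqrt q] \<open>x \<noteq> 0\<close> by simp
    moreover have "dist (m t i) (m t l) = sqrt ((x + t *\<^sub>R y) \<bullet> (x + t *\<^sub>R y))" for t
    proof -
      have "m t l - m t i = x + t *\<^sub>R y" using that by (simp add: m_def move_vertex_def x_def)
      then show ?thesis
        unfolding norm_eq_sqrt_inner[symmetric] dist_norm norm_minus_commute[of "m t i"] by simp
    qed
    moreover have "\<delta>L $ edge i l = inverse (sqrt (x \<bullet> x)) / 2 * (2 * (x \<bullet> y))"
    proof -
      have "\<delta>L $ edge i l = y \<bullet> x / norm x"
        using \<delta>L that unfolding length_velocity_def x_def by blast
      moreover have "inverse n / 2 * (2 * z) = z / n" for n z :: real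
        by (simp add: field_simps)
      ultimately show ?thesis
        by (simp only: norm_eq_sqrt_inner inner_commute[of y x])
    qed
    ultimately show ?thesis by (simp only:)
  qed
  have comp: "((\<lambda>t. \<Lambda> t $ e) has_real_derivative \<delta>L $ e) (at 0)" for e
  proof -
    obtain i j where e: "i \<noteq> j" "e = edge i j" by (rule edge_cases)
    consider "i \<noteq> l" "j \<noteq> l" | "i \<noteq> l" "j = l" | "j \<noteq> l" "i = l" using e by auto
    then show ?thesis
    proof cases
      case 1
      then show ?thesis
        using e \<delta>L by (simp add: \<Lambda> m_def move_vertex_def length_velocity_def)
    next
      case 2
      then show ?thesis using e dist_l[of i] by (simp add: \<Lambda>)
    next
      case 3
      then show ?thesis using e dist_l[of j] by (simp add: \<Lambda> dist_commute edge_commute)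
    qed
  qed
  have d\<Lambda>: "(\<Lambda> has_derivative (\<lambda>h. h *\<^sub>R \<delta>L)) (at 0)"
    unfolding has_derivative_componentwise_within[of \<Lambda>]
  proof
    fix b :: "real^edge" assume "b \<in> Basis"
    then obtain e where b: "b = axis e 1" by (auto simp: Basis_vec_def)
    show "((\<lambda>t. \<Lambda> t \<bullet> b) has_derivative (\<lambda>h. h *\<^sub>R \<delta>L \<bullet> b)) (at 0)"
      using comp[of e] by (simp add: b inner_axis has_field_derivative_def mult_commute_abs)
  qed
  have "\<forall>\<^sub>F t in nhds 0. tet_det (m t) i j k l \<noteq> 0"
  proof -
    have "tet_det v i j k l \<noteq> 0" using v realizes_iff_tet_det[OF ijkl] by simp
    from eventually_line_ne_0[OF this, of "((v j - v i) \<times> (v k - v i)) \<bullet> y"]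
    show ?thesis
      by eventually_elim
        (use ijkl in \<open>auto simp: tet_det_def m_def move_vertex_def algebra_simps inner_add_right inner_diff_right\<close>)
  qed
  then have real: "\<forall>\<^sub>F t in nhds 0. realizes (\<Lambda> t) (m t)"
    by eventually_elim (simp add: realizes_iff_tet_det[OF ijkl] \<Lambda>)
  have ev: "\<forall>\<^sub>F t in nhds 0. dihedral_angle (\<Lambda> t) p q r s =
      vec_angle (perp_part (m t q - m t p) (m t r - m t p)) (perp_part (m t q - m t p) (m t s - m t p))"
    using real by eventually_elim (rule dihedral_angle_eq)
  have D1: "((\<lambda>t. dihedral_angle (\<Lambda> t) p q r s) has_real_derivative B) (at 0)"
    unfolding DERIV_cong_ev[OF refl ev refl] using B by (simp add: Let_def m_def)
  have "(\<lambda>L. dihedral_angle L p q r s) differentiable (at (\<Lambda> 0))"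
    unfolding \<Lambda>0 by (rule dihedral_angle_differentiable[OF v pqrs])
  then have "((\<lambda>L. dihedral_angle L p q r s) has_derivative
      frechet_derivative (\<lambda>L. dihedral_angle L p q r s) (at (\<Lambda> 0))) (at (\<Lambda> 0))"
    by (simp add: frechet_derivative_works)
  from diff_chain_at[OF d\<Lambda> this]
  have "((\<lambda>t. dihedral_angle (\<Lambda> t) p q r s) has_derivative
      (\<lambda>h. frechet_derivative (\<lambda>L. dihedral_angle L p q r s) (at L) (h *\<^sub>R \<delta>L))) (at 0)"
    by (simp add: o_def \<Lambda>0)
  moreover have "((\<lambda>t. dihedral_angle (\<Lambda> t) p q r s) has_derivative (\<lambda>h. B * h)) (at 0)"
    using D1 by (simp add: has_field_derivative_def)
  ultimately have "(\<lambda>h. frechet_derivative (\<lambda>L. dihedral_angle L p q r s) (at L) (h *\<^sub>R \<delta>L)) = (\<lambda>h. B * h)"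
    by (rule has_derivative_unique)
  from fun_cong[OF this, of 1] show ?thesis
    by (simp add: dihedral_variation_def)
qed

text \<open>
  The velocity \<open>y\<close> of \<open>l\<close> normal to the face \<open>{i, j, l}\<close>, directed away from \<open>k\<close>, divided by twice the area
  of this face. All variations of dihedral angles are combinations of the three numbers belonging to the faces
  at the moving vertex.
\<close>

definition face_rate :: "('a \<Rightarrow> real^3) \<Rightarrow> real^3 \<Rightarrow> 'a \<Rightarrow> 'a \<Rightarrow> 'a \<Rightarrow> 'a \<Rightarrow> real" where
  "face_rate v y i j k l = sgn (tet_det v i j k l) * (y \<bullet> ((v j - v i) \<times> (v l - v i)))
     / (norm ((v j - v i) \<times> (v l - v i)))\<^sup>2"

text \<open>
  Both the volume and the face normal change sign when the endpoints of the edge are exchanged.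
\<close>

lemma face_rate_swap: "face_rate v y i j k l = face_rate v y j i k l"
proof -
  have *: "(v i - v j) \<times> (w - v j) = (v j - v i) \<times> (v i - w) " for w
    by (simp add: Cross3.left_diff_distrib Cross3.right_diff_distrib cross_skew[of "v j" "v i"])
  have c: "(v i - v j) \<times> (v l - v j) = - ((v j - v i) \<times> (v l - v i))"
    unfolding * by (simp add: Cross3.right_diff_distrib)
  have "tet_det v j i k l = - (((v j - v i) \<times> (v k - v i)) \<bullet> (v l - v i - (v j - v i)))"
    unfolding tet_det_def * by (simp add: Cross3.right_diff_distrib inner_diff_left)
  also have "\<dots> = - tet_det v i j k l"
    unfolding tet_det_def inner_diff_right[of _ "v l - v i"] by (simp add: dot_cross_self)
  finally have d: "tet_det v j i k l = - tet_det v i j k l" .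
  show ?thesis
    unfolding face_rate_def c d by simp
qed

lemma dihedral_variation_opposite:
  assumes v: "realizes L v" and ijkl: "distinct [i, j, k, l]" and \<delta>L: "length_velocity v l y \<delta>L"
  shows "dihedral_variation L \<delta>L i j k l = norm (v j - v i) * face_rate v y i j k l"
proof (rule dihedral_variation_move_vertex[OF v ijkl ijkl \<delta>L])
  have "((v j - v i) \<times> (v k - v i)) \<bullet> (v l - v i) \<noteq> 0"
    using v realizes_iff_tet_det[OF ijkl] by (simp add: tet_det_def)
  from dihedral_derivative_opposite[OF this, of y]
  show "((\<lambda>t. let m = move_vertex v l y t in
         vec_angle (perp_part (m j - m i) (m k - m i)) (perp_part (m j - m i) (m l - m i)))
       has_real_derivative norm (v j - v i) * face_rate v y i j k l) (at 0)"
    using ijkl by (simp add: move_vertex_def face_rate_def tet_det_def algebra_simps)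
qed

lemma dihedral_variation_adjacent:
  assumes v: "realizes L v" and ijkl: "distinct [i, j, k, l]" and \<delta>L: "length_velocity v l y \<delta>L"
  shows "dihedral_variation L \<delta>L i l j k =
    - (((v j - v i) \<bullet> (v l - v i)) * face_rate v y i j k l
       + ((v k - v i) \<bullet> (v l - v i)) * face_rate v y i k j l) / norm (v l - v i)"
proof -
  define e where "e = v l - v i"
  define a where "a = v j - v i"
  define b where "b = v k - v i"
  have D: "tet_det v i j k l = (e \<times> a) \<bullet> b" "tet_det v i k j l = - ((e \<times> a) \<bullet> b)"
    unfolding tet_det_def e_def[symmetric] a_def[symmetric] b_def[symmetric]
    by (metis cross_triple) (metis cross_skew cross_triple inner_minus_left)
  have nz: "(e \<times> a) \<bullet> b \<noteq> 0"
    using v realizes_iff_tet_det[OF ijkl] D by simp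
  have fr: "face_rate v y i j k l = - sgn ((e \<times> a) \<bullet> b) * (y \<bullet> (e \<times> a)) / (norm (e \<times> a))\<^sup>2"
    "face_rate v y i k j l = sgn ((e \<times> a) \<bullet> b) * (y \<bullet> (e \<times> b)) / (norm (e \<times> b))\<^sup>2"
    unfolding face_rate_def D e_def[symmetric] a_def[symmetric] b_def[symmetric]
      cross_skew[of a e] cross_skew[of b e] by (simp_all add: sgn_minus)
  have iljk: "distinct [i, l, j, k]" using ijkl by auto
  show ?thesis
  proof (rule dihedral_variation_move_vertex[OF v ijkl iljk \<delta>L])
    have mm: "move_vertex v l y t l - move_vertex v l y t i = e + t *\<^sub>R y"
      "move_vertex v l y t j - move_vertex v l y t i = a"
      "move_vertex v l y t k - move_vertex v l y t i = b" for t
      using ijkl by (simp_all add: move_vertex_def e_def a_def b_def)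
    have eq: "- ((a \<bullet> e) * face_rate v y i j k l + (b \<bullet> e) * face_rate v y i k j l) / norm e
     = sgn ((e \<times> a) \<bullet> b) * ((e \<bullet> a) * (y \<bullet> (e \<times> a)) / (norm (e \<times> a))\<^sup>2
       - (e \<bullet> b) * (y \<bullet> (e \<times> b)) / (norm (e \<times> b))\<^sup>2) / norm e"
      unfolding fr by (simp add: inner_commute algebra_simps)
    show "((\<lambda>t. let m = move_vertex v l y t in
         vec_angle (perp_part (m l - m i) (m j - m i)) (perp_part (m l - m i) (m k - m i)))
       has_real_derivative - (((v j - v i) \<bullet> (v l - v i)) * face_rate v y i j k l
       + ((v k - v i) \<bullet> (v l - v i)) * face_rate v y i k j l) / norm (v l - v i)) (at 0)"
      unfolding Let_def mm unfolding e_def[symmetric] a_def[symmetric] b_def[symmetric] eq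
      by (rule dihedral_derivative_adjacent[OF nz])
  qed
qed

section \<open>The variation formulas\<close>

text \<open>
  The sum on the left splits into contributions of the two moving faces at the edge \<open>{i, l}\<close>. In the face
  through \<open>m\<close>, the numbers \<open>d i m\<close> and \<open>d i l\<close> are components of \<open>c - v i\<close>, and they combine to its component
  along the in-plane normal of the edge, which is \<open>h_edge d i l m\<close> up to scaling. Since \<open>l\<close> moves
  along the line through \<open>c\<close>, the normal velocity is proportional to the distance of \<open>c\<close> from the face, that
  is, to \<open>h_face d i l m n\<close>. The product of the two is one of the two triangles that form the dual area.
\<close>

lemma vertex_identity:
  assumes v: "realizes (edge_lengths d) v" and c: "is_center d v c" and ijkl: "distinct [i, j, k, l]"
    and \<delta>L: "length_velocity v l (\<delta>f *\<^sub>R (v l - c)) \<delta>L"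
  shows "let L = edge_lengths d; \<delta>\<beta> = dihedral_variation L \<delta>L in
    d i l * \<delta>\<beta> i l j k + d i j * \<delta>\<beta> i j k l + d i k * \<delta>\<beta> i k j l
      = 2 * (dual_area d i l j k / L $ edge i l) * \<delta>f"
proof -
  define e where "e = v l - v i"
  define y where "y = \<delta>f *\<^sub>R (v l - c)"
  note vl = \<delta>L[folded y_def]
  have iljk: "distinct [i, l, j, k]" "distinct [i, l, k, j]" "distinct [i, k, j, l]"
    using ijkl by auto
  have len: "edge_lengths d $ edge i l = norm e"
    using v ijkl by (simp add: realizes_def e_def dist_norm norm_minus_commute)
  define C where "C = c - v i"
  have nzt: "tet_det v i l m n \<noteq> 0" if "distinct [i, l, m, n]" for m n
    using v realizes_iff_tet_det[OF that] by simp
  have Cl: "d i l * norm e = C \<bullet> e"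
    using c ijkl by (simp add: is_center_def C_def e_def)
  \<comment> \<open>the contribution of the face through \<open>m\<close>; \<open>n\<close> is the remaining vertex\<close>
  have split: "d i m * (norm (v m - v i) * face_rate v y i m n l)
      - d i l * ((v m - v i) \<bullet> e * face_rate v y i m n l / norm e)
     = h_edge d i l m * h_face d i l m n / norm e * \<delta>f"
    if imn: "distinct [i, l, m, n]" for m n
  proof -
    define a where "a = v m - v i"
    define b where "b = v n - v i"
    have D: "(e \<times> a) \<bullet> b \<noteq> 0"
      using nzt[OF imn] by (simp add: tet_det_def e_def a_def b_def)
    then have nz: "e \<noteq> 0" "a \<noteq> 0" "e \<times> a \<noteq> 0" by auto
    have tt: "tet_det v i m n l = (e \<times> a) \<bullet> b"
      unfolding tet_det_def e_def a_def b_def by (metis cross_triple)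
    have "y \<bullet> (a \<times> e) = \<delta>f * ((e \<times> a) \<bullet> C)"
    proof -
      have "y = \<delta>f *\<^sub>R (e - C)" by (simp add: y_def e_def C_def)
      then show ?thesis
        unfolding cross_skew[of a e] by (simp add: inner_diff_left inner_diff_right dot_cross_self inner_commute)
    qed
    then have fr: "face_rate v y i m n l = sgn ((e \<times> a) \<bullet> b) * (\<delta>f * ((e \<times> a) \<bullet> C)) / (norm (e \<times> a))\<^sup>2"
      unfolding face_rate_def tt e_def[symmetric] a_def[symmetric] cross_skew[of a e] by simp
    have hf: "h_face d i l m n = sgn ((e \<times> a) \<bullet> b) * ((e \<times> a) \<bullet> C) / norm (e \<times> a)"
      unfolding h_face_center[OF v c imn] tet_det_def by (simp add: e_def a_def b_def C_def)
    have he: "h_edge d i l m = ((e \<times> a) \<bullet> (e \<times> C)) / (norm e * norm (e \<times> a))"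
      using h_edge_center[OF v c, of i l m] imn nz by (simp add: e_def a_def C_def)
    have Cm: "d i m * norm a = C \<bullet> a"
      using c imn by (auto simp: is_center_def C_def a_def)
    have coefficient: "d i m * (norm a * F) - d i l * (a \<bullet> e * F / norm e)
        = (e \<times> a) \<bullet> (e \<times> C) / (norm e)\<^sup>2 * F" for F
    proof -
      have "d i l = C \<bullet> e / norm e" using Cl nz by (simp add: field_simps)
      then have "d i m * (norm a * F) - d i l * (a \<bullet> e * F / norm e)
        = (C \<bullet> a - (C \<bullet> e) * (a \<bullet> e) / (norm e)\<^sup>2) * F"
        using Cm by (simp add: algebra_simps power2_eq_square)
      also have "C \<bullet> a - (C \<bullet> e) * (a \<bullet> e) / (norm e)\<^sup>2 = (e \<times> a) \<bullet> (e \<times> C) / (norm e)\<^sup>2"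
        using nz by (simp add: dot_cross power2_norm_eq_inner field_simps inner_commute)
      finally show ?thesis .
    qed
    show ?thesis
      unfolding a_def[symmetric] coefficient fr hf he by (simp add: power2_eq_square mult_ac)
  qed
  have "d i l * dihedral_variation (edge_lengths d) \<delta>L i l j k
     + d i j * dihedral_variation (edge_lengths d) \<delta>L i j k l + d i k * dihedral_variation (edge_lengths d) \<delta>L i k j l
    = h_edge d i l j * h_face d i l j k / norm e * \<delta>f + h_edge d i l k * h_face d i l k j / norm e * \<delta>f"
    unfolding split[OF iljk(1), symmetric] split[OF iljk(2), symmetric]
      dihedral_variation_adjacent[OF v ijkl vl] dihedral_variation_opposite[OF v ijkl vl]
      dihedral_variation_opposite[OF v iljk(3) vl] e_def[symmetric]
    by (simp add: algebra_simps add_divide_distrib diff_divide_distrib)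
  also have "\<dots> = 2 * (dual_area d i l j k / edge_lengths d $ edge i l) * \<delta>f"
    unfolding len dual_area_def by (simp add: algebra_simps add_divide_distrib)
  finally show ?thesis by (simp add: Let_def)
qed

text \<open>
  The Schlaefli identity for variations of this kind. It holds separately for each moving face: the
  contributions of the edge \<open>{p, q}\<close> and of the two edges at \<open>l\<close> to the coefficient of the face rate cancel, because
  the projections of the other two sides on \<open>{p, q}\<close> add up to its length.
\<close>

lemma schlaefli_moving_vertex:
  assumes v: "realizes L v" and ijkl: "distinct [i, j, k, l]" and \<delta>L: "length_velocity v l y \<delta>L"
  shows "let \<delta>\<beta> = dihedral_variation L \<delta>L in
    L $ edge i j * \<delta>\<beta> i j k l + L $ edge i k * \<delta>\<beta> i k j l + L $ edge j k * \<delta>\<beta> j k i l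
    + L $ edge i l * \<delta>\<beta> i l j k + L $ edge j l * \<delta>\<beta> j l i k + L $ edge k l * \<delta>\<beta> k l i j = 0"
proof -
  have len: "L $ edge p q = norm (v q - v p)" if "p \<noteq> q" for p q
    using v that by (simp add: realizes_def dist_norm norm_minus_commute flip: edge_commute)
  have opp: "L $ edge p q * dihedral_variation L \<delta>L p q r l = (norm (v q - v p))\<^sup>2 * face_rate v y p q r l"
    if "distinct [p, q, r, l]" for p q r
    using dihedral_variation_opposite[OF v that \<delta>L] that by (simp add: len power2_eq_square)
  have adj: "L $ edge p l * dihedral_variation L \<delta>L p l q r =
      - ((v q - v p) \<bullet> (v l - v p)) * face_rate v y p q r l
      - ((v r - v p) \<bullet> (v l - v p)) * face_rate v y p r q l"
    if "distinct [p, q, r, l]" for p q r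
  proof -
    have "norm (v l - v p) \<noteq> 0" using v that by (auto simp: realizes_def inj_eq)
    then show ?thesis
      using dihedral_variation_adjacent[OF v that \<delta>L] that by (simp add: len)
  qed
  have face: "(norm (v q - v p))\<^sup>2 = (v q - v p) \<bullet> (v l - v p) + (v p - v q) \<bullet> (v l - v q)" for p q
    by (simp add: power2_norm_eq_inner inner_diff_left inner_diff_right inner_commute)
  have perms: "distinct [i, k, j, l]" "distinct [j, k, i, l]" "distinct [j, i, k, l]" "distinct [k, i, j, l]"
    using ijkl by auto
  show ?thesis
    unfolding Let_def opp[OF ijkl] opp[OF perms(1)] opp[OF perms(2)]
      adj[OF ijkl] adj[OF perms(3)] adj[OF perms(4)] face
      face_rate_swap[of v y j i] face_rate_swap[of v y k i] face_rate_swap[of v y k j]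
    by algebra
qed

lemma distinct_vertices: "distinct [1, 2, 3, 4 :: 4]"
  by simp

theorem theorem31:
  fixes d :: "4 \<Rightarrow> 4 \<Rightarrow> real" and \<delta>L :: "real^edge" and \<delta>f :: real
  assumes "tetrahedron_metric d"
    and "\<delta>L $ edge 1 2 = 0" and "\<delta>L $ edge 1 3 = 0" and "\<delta>L $ edge 2 3 = 0"
    and "\<delta>L $ edge 1 4 = d 4 1 * \<delta>f"
    and "\<delta>L $ edge 2 4 = d 4 2 * \<delta>f"
    and "\<delta>L $ edge 3 4 = d 4 3 * \<delta>f"
  shows "(\<forall>i j k l. distinct [i, j, k, l] \<longrightarrow>
           (\<lambda>L. dihedral_angle L i j k l) differentiable (at (edge_lengths d)))
         \<and> (let L = edge_lengths d;
             \<delta>\<beta> = dihedral_variation L \<delta>L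
         in d 1 4 * \<delta>\<beta> 1 4 2 3 + d 1 2 * \<delta>\<beta> 1 2 3 4 + d 1 3 * \<delta>\<beta> 1 3 2 4
              = 2 * (dual_area d 1 4 2 3 / L $ edge 1 4) * \<delta>f
          \<and> d 2 4 * \<delta>\<beta> 2 4 1 3 + d 2 3 * \<delta>\<beta> 2 3 1 4 + d 2 1 * \<delta>\<beta> 1 2 3 4
              = 2 * (dual_area d 2 4 1 3 / L $ edge 2 4) * \<delta>f
          \<and> d 3 4 * \<delta>\<beta> 3 4 1 2 + d 3 2 * \<delta>\<beta> 2 3 1 4 + d 3 1 * \<delta>\<beta> 1 3 2 4
              = 2 * (dual_area d 3 4 1 2 / L $ edge 3 4) * \<delta>f
          \<and> d 4 1 * \<delta>\<beta> 1 4 2 3 + d 4 2 * \<delta>\<beta> 2 4 1 3 + d 4 3 * \<delta>\<beta> 3 4 1 2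
              = (- 2 * (dual_area d 1 4 2 3 / L $ edge 1 4)
                 - 2 * (dual_area d 2 4 1 3 / L $ edge 2 4)
                 - 2 * (dual_area d 3 4 1 2 / L $ edge 3 4)) * \<delta>f)"
proof -
  define L where "L = edge_lengths d"
  obtain v where v: "realizes L v"
    using assms(1) by (auto simp: tetrahedron_metric_def L_def)
  obtain c where c: "is_center d v c"
    using exists_center[OF assms(1)] v by (auto simp: L_def)
  have diff: "\<forall>i j k l. distinct [i, j, k, l] \<longrightarrow>
      (\<lambda>L. dihedral_angle L i j k l) differentiable (at L)"
    using dihedral_angle_differentiable[OF v] by blast
  have len: "L $ edge i j = d i j + d j i" if "i \<noteq> j" for i j
    using that by (simp add: L_def edge_lengths_edge)
  \<comment> \<open>the given variation comes from pushing vertex 4 straight away from the center\<close>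
  have \<delta>L: "length_velocity v 4 (\<delta>f *\<^sub>R (v 4 - c)) \<delta>L"
  proof -
    have "(\<delta>f *\<^sub>R (v 4 - c)) \<bullet> (v 4 - v i) / norm (v 4 - v i) = d 4 i * \<delta>f" if "i \<noteq> 4" for i
    proof -
      have "v 4 - v i \<noteq> 0" using v that by (auto simp: realizes_def inj_eq)
      moreover have "(v 4 - c) \<bullet> (v 4 - v i) = d 4 i * norm (v 4 - v i)"
        using c that unfolding is_center_def
        by (metis inner_minus_left inner_minus_right minus_diff_eq norm_minus_commute)
      ultimately show ?thesis by simp
    qed
    moreover have "\<delta>L $ edge i 4 = d 4 i * \<delta>f" if "i \<noteq> 4" for i
      using exhaust_4[of i] that assms(5-7) by auto
    moreover have "\<delta>L $ edge i j = 0" if "i \<noteq> j" "i \<noteq> 4" "j \<noteq> 4" for i j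
      using exhaust_4[of i] exhaust_4[of j] that assms(2-4)
        edge_commute[of 2 1] edge_commute[of 3 1] edge_commute[of 3 2] by auto
    ultimately show ?thesis by (simp add: length_velocity_def)
  qed
  define \<delta>\<beta> where "\<delta>\<beta> = dihedral_variation L \<delta>L"
  have sym: "\<delta>\<beta> p q r 4 = \<delta>\<beta> q p r 4" if "distinct [p, q, r, 4]" for p q r
  proof -
    have swapped: "distinct [q, p, r, 4]" using that by auto
    show ?thesis
      unfolding \<delta>\<beta>_def dihedral_variation_opposite[OF v that \<delta>L]
        dihedral_variation_opposite[OF v swapped \<delta>L] face_rate_swap[of v _ q p]
      by (simp add: norm_minus_commute)
  qed
  note eqs = vertex_identity[OF v[unfolded L_def] c _ \<delta>L, folded L_def, unfolded Let_def, folded \<delta>\<beta>_def]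
  have 1: "d 1 4 * \<delta>\<beta> 1 4 2 3 + d 1 2 * \<delta>\<beta> 1 2 3 4 + d 1 3 * \<delta>\<beta> 1 3 2 4
      = 2 * (dual_area d 1 4 2 3 / L $ edge 1 4) * \<delta>f"
    using eqs[of 1 2 3] by simp
  have 2: "d 2 4 * \<delta>\<beta> 2 4 1 3 + d 2 3 * \<delta>\<beta> 2 3 1 4 + d 2 1 * \<delta>\<beta> 1 2 3 4
      = 2 * (dual_area d 2 4 1 3 / L $ edge 2 4) * \<delta>f"
    using eqs[of 2 1 3] sym[of 1 2 3] by simp
  have 3: "d 3 4 * \<delta>\<beta> 3 4 1 2 + d 3 2 * \<delta>\<beta> 2 3 1 4 + d 3 1 * \<delta>\<beta> 1 3 2 4
      = 2 * (dual_area d 3 4 1 2 / L $ edge 3 4) * \<delta>f"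
    using eqs[of 3 1 2] sym[of 1 3 2] sym[of 2 3 1] by simp
  have "L $ edge 1 2 * \<delta>\<beta> 1 2 3 4 + L $ edge 1 3 * \<delta>\<beta> 1 3 2 4 + L $ edge 2 3 * \<delta>\<beta> 2 3 1 4
    + L $ edge 1 4 * \<delta>\<beta> 1 4 2 3 + L $ edge 2 4 * \<delta>\<beta> 2 4 1 3 + L $ edge 3 4 * \<delta>\<beta> 3 4 1 2 = 0"
    using schlaefli_moving_vertex[OF v distinct_vertices \<delta>L] by (simp add: \<delta>\<beta>_def Let_def)
  \<comment> \<open>subtract the first three identities from the Schlaefli identity, where each length is \<open>d i j + d j i\<close>\<close>
  then have 4: "d 4 1 * \<delta>\<beta> 1 4 2 3 + d 4 2 * \<delta>\<beta> 2 4 1 3 + d 4 3 * \<delta>\<beta> 3 4 1 2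
      = (- 2 * (dual_area d 1 4 2 3 / L $ edge 1 4)
         - 2 * (dual_area d 2 4 1 3 / L $ edge 2 4)
         - 2 * (dual_area d 3 4 1 2 / L $ edge 3 4)) * \<delta>f"
    unfolding left_diff_distrib mult_minus_left 1[symmetric] 2[symmetric] 3[symmetric]
    by (simp add: len algebra_simps)
  show ?thesis
    unfolding Let_def L_def[symmetric] \<delta>\<beta>_def[symmetric]
    using diff 1 2 3 4 by blast
qed

end
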